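(* Let $p\ge 3$ be a prime, let $l$ be an odd positive divisor of $p-1$, and write $l=(p-1)/q$ with $q$ a positive integer. Let $\chi$ be a Dirichlet character modulo $p$ of order $q$, and let $$E=\frac{2}{q}\sum_{\substack{j=1\\ j\text{ odd}}}^{q-1}B_{\chi^j}.$$ Then $E\neq 0$.
   Context: For a Dirichlet character $\psi$ modulo $p$ (complex-valued), the generalized Bernoulli number (of order $1$) belonging to $\psi$ is $$B_\psi=\frac1p\sum_{k=1}^{p-1}k\,\psi(k).$$ The order of a character is its order in the group of Dirichlet characters modulo $p$. Since $l$ is odd and $p-1$ is even, $q$ is even. *)

theory Defs
  imports
    Complex_Main
    "HOL-Computational_Algebra.Primes"
    "HOL-Algebra.Multiplicative_Group"
begin

definition dirichlet_character :: "nat \<Rightarrow> (int \<Rightarrow> complex) \<Rightarrow> bool" where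
  "dirichlet_character n \<chi> \<longleftrightarrow>
     (\<forall>a b. \<chi> (a * b) = \<chi> a * \<chi> b) \<and>
     (\<forall>a. \<chi> (a + int n) = \<chi> a) \<and>
     (\<forall>a. \<chi> a = 0 \<longleftrightarrow> \<not> coprime a (int n))"

definition principal_character :: "nat \<Rightarrow> int \<Rightarrow> complex" where
  "principal_character n a = (if coprime a (int n) then 1 else 0)"

definition dirichlet_characters :: "nat \<Rightarrow> (int \<Rightarrow> complex) monoid" where
  "dirichlet_characters n =
     \<lparr>carrier = {\<chi>. dirichlet_character n \<chi>},
      mult = (\<lambda>\<chi> \<psi> a. \<chi> a * \<psi> a),
      one = principal_character n\<rparr>"

(* Only the generalized Bernoulli number of order 1. *)
definition generalized_bernoulli :: "nat \<Rightarrow> (int \<Rightarrow> complex) \<Rightarrow> complex" where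
  "generalized_bernoulli p \<psi> = (1 / of_nat p) * (\<Sum>k = 1..p - 1. of_nat k * \<psi> (int k))"

lemma dirichlet_character_principal: "dirichlet_character n (principal_character n)"
proof -
  have "coprime (a + int n) (int n) \<longleftrightarrow> coprime a (int n)" for a
    by (simp add: coprime_iff_gcd_eq_1)
  then show ?thesis
    by (auto simp: dirichlet_character_def principal_character_def)
qed

lemma comm_group_dirichlet_characters: "comm_group (dirichlet_characters n)"
proof (rule comm_groupI)
  fix \<chi> assume "\<chi> \<in> carrier (dirichlet_characters n)"
  then have \<chi>: "dirichlet_character n \<chi>"
    by (simp add: dirichlet_characters_def)
  then have "dirichlet_character n (\<lambda>a. inverse (\<chi> a))"
    by (auto simp: dirichlet_character_def)
  moreover have "(\<lambda>a. inverse (\<chi> a) * \<chi> a) = principal_character n"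
    using \<chi> by (auto simp: dirichlet_character_def principal_character_def fun_eq_iff)
  ultimately show "\<exists>\<psi>\<in>carrier (dirichlet_characters n).
      \<psi> \<otimes>\<^bsub>dirichlet_characters n\<^esub> \<chi> = \<one>\<^bsub>dirichlet_characters n\<^esub>"
    by (auto simp: dirichlet_characters_def intro!: exI[of _ "\<lambda>a. inverse (\<chi> a)"])
next
  fix \<chi> assume "\<chi> \<in> carrier (dirichlet_characters n)"
  then have "\<chi> a = 0" if "\<not> coprime a (int n)" for a
    using that by (simp add: dirichlet_characters_def dirichlet_character_def)
  then show "\<one>\<^bsub>dirichlet_characters n\<^esub> \<otimes>\<^bsub>dirichlet_characters n\<^esub> \<chi> = \<chi>"
    by (auto simp: dirichlet_characters_def principal_character_def fun_eq_iff)
next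
  show "\<one>\<^bsub>dirichlet_characters n\<^esub> \<in> carrier (dirichlet_characters n)"
    by (simp add: dirichlet_characters_def dirichlet_character_principal)
qed (auto simp: dirichlet_characters_def dirichlet_character_def mult_ac)

(* For j = 0 the group power is the principal character, whereas a ^ 0 is always 1. *)
lemma dirichlet_characters_pow:
  "(\<chi> [^]\<^bsub>dirichlet_characters n\<^esub> j) a = \<chi> a ^ j"
  if "dirichlet_character n \<chi>" "0 < j" for j :: nat
proof -
  interpret comm_group "dirichlet_characters n" by (rule comm_group_dirichlet_characters)
  have "\<chi> [^]\<^bsub>dirichlet_characters n\<^esub> Suc i = (\<lambda>a. \<chi> a ^ Suc i)" for i :: nat
  proof (induction i)
    case 0
    have "\<chi> \<in> carrier (dirichlet_characters n)"
      using that by (simp add: dirichlet_characters_def)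
    then show ?case by simp
  next
    case (Suc i)
    have "\<chi> [^]\<^bsub>dirichlet_characters n\<^esub> Suc (Suc i) =
        (\<chi> [^]\<^bsub>dirichlet_characters n\<^esub> Suc i) \<otimes>\<^bsub>dirichlet_characters n\<^esub> \<chi>"
      by (rule nat_pow_Suc)
    then show ?case unfolding Suc by (simp add: dirichlet_characters_def mult_ac)
  qed
  then show "(\<chi> [^]\<^bsub>dirichlet_characters n\<^esub> j) a = \<chi> a ^ j"
    using \<open>0 < j\<close> by (cases j) auto
qed

end

theory Submission
  imports Defs "HOL-Number_Theory.Residue_Primitive_Roots"
begin

text \<open>
  Orthogonality turns the sum over odd powers of \<open>\<chi>\<close> into
  \<open>p E = (\<Sum>\<chi>(k)=1. k) - (\<Sum>\<chi>(k)=-1. k)\<close>. The kernel of \<open>\<chi>\<close> has odd order \<open>l\<close>, so it omits \<open>-1\<close>;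
  hence \<open>\<chi>(-1) = -1\<close> and \<open>k \<mapsto> p - k\<close> exchanges the two ranges of summation. Therefore
  \<open>p E = 2 (\<Sum>\<chi>(k)=1. k) - p l\<close> is an odd integer.
\<close>

text \<open>With \<open>q = 2 * r\<close> the sum is \<open>z\<close> times the geometric series in
  \<open>z ^ 2\<close> with \<open>r\<close> terms. As \<open>(z ^ 2) ^ r = z ^ q = 1\<close>, the
  series vanishes unless \<open>z ^ 2 = 1\<close>, where it equals \<open>r = q / 2\<close>.\<close>

lemma sum_odd_powers_root_of_unity:
  fixes z :: complex
  assumes z: "z ^ q = 1" and "even q"
  shows "(\<Sum>j | j \<in> {1..q - 1} \<and> odd j. z ^ j) =
    of_nat q / 2 * (if z = 1 then 1 else if z = -1 then -1 else 0)"
proof -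
  obtain r where q: "q = 2 * r" using \<open>even q\<close> by (elim evenE)
  have "{j. j \<in> {1..q - 1} \<and> odd j} = (\<lambda>i. Suc (2 * i)) ` {..<r}"
    by (auto simp: q elim!: oddE)
  then have "(\<Sum>j | j \<in> {1..q - 1} \<and> odd j. z ^ j) = z * (\<Sum>i<r. (z ^ 2) ^ i)"
    by (simp add: sum.reindex inj_on_def sum_distrib_left power_mult)
  also have "\<dots> = of_nat q / 2 * (if z = 1 then 1 else if z = -1 then -1 else 0)"
  proof (cases "z\<^sup>2 = 1")
    case True
    then show ?thesis by (auto simp: q power2_eq_1_iff)
  next
    case False
    then show ?thesis using z by (auto simp: q geometric_sum power_mult)
  qed
  finally show ?thesis .
qed

text \<open>The definition only grants invariance under adding \<open>n\<close> once; induction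
  extends it to natural multiples of \<open>n\<close>. A negative multiple is handled by shifting
  from \<open>b\<close> to \<open>a\<close> instead.\<close>

lemma dirichlet_character_cong:
  assumes "dirichlet_character n \<chi>" and "[a = b] (mod int n)"
  shows "\<chi> a = \<chi> b"
proof -
  have nat: "\<chi> (c + int n * int m) = \<chi> c" for c m
  proof (induction m)
    case (Suc m)
    have "\<chi> ((c + int n * int m) + int n) = \<chi> (c + int n * int m)"
      using assms(1) by (simp add: dirichlet_character_def)
    then show ?case using Suc by (simp add: algebra_simps)
  qed simp
  obtain k where k: "b = a + int n * k"
    using assms(2) by (auto simp: cong_iff_lin)
  show ?thesis
  proof (cases "k \<ge> 0")
    case True
    then show ?thesis using nat[of a "nat k"] k by simp
  next
    case False
    then show ?thesis using nat[of b "nat (- k)"] k by simp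
  qed
qed

lemma dirichlet_character_one:
  assumes "dirichlet_character n \<chi>"
  shows "\<chi> 1 = 1"
proof -
  have "\<chi> (1 * 1) = \<chi> 1 * \<chi> 1" "\<chi> 1 \<noteq> 0"
    using assms unfolding dirichlet_character_def by (blast, simp)
  then show ?thesis by simp
qed

lemma dirichlet_character_power:
  assumes "dirichlet_character n \<chi>"
  shows "\<chi> (a ^ i) = \<chi> a ^ i"
proof (induction i)
  case (Suc i)
  have "\<chi> (a * a ^ i) = \<chi> a * \<chi> (a ^ i)"
    using assms unfolding dirichlet_character_def by blast
  with Suc show ?case by simp
qed (simp add: dirichlet_character_one[OF assms])

theorem mainTheorem2:
  fixes p l q :: nat and \<chi> :: "int \<Rightarrow> complex" and E :: complex
  assumes "prime p" and "p \<ge> 3"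
    and "odd l" and "l dvd p - 1"
    and "q > 0" and "real l = real (p - 1) / real q"
    and "\<chi> \<in> carrier (dirichlet_characters p)"
    and "group.ord (dirichlet_characters p) \<chi> = q"
    and "E = (2 / of_nat q) *
           (\<Sum>j | j \<in> {1..q - 1} \<and> odd j.
              generalized_bernoulli p (\<chi> [^]\<^bsub>dirichlet_characters p\<^esub> j))"
  shows "E \<noteq> 0"
proof -
  interpret D: comm_group "dirichlet_characters p" by (rule comm_group_dirichlet_characters)
  have \<chi>: "dirichlet_character p \<chi>"
    using assms(7) by (simp add: dirichlet_characters_def)
  note cong = dirichlet_character_cong[OF \<chi>]
  have "odd p" using assms(1,2) prime_odd_nat by force
  have "real (p - 1) = real (l * q)"
    using assms(5,6) by (simp add: field_simps)
  then have lq: "p - 1 = l * q" by (simp only: of_nat_eq_iff)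
  \<comment> \<open>An odd divisor \<open>l\<close> of the even number \<open>p - 1\<close> leaves
    the whole factor 2 in \<open>q\<close>; the sum over odd powers relies on this.\<close>
  then have "even (l * q)" using \<open>odd p\<close> by (simp flip: lq)
  then have "even q" using \<open>odd l\<close> by simp
  have unit: "coprime (int k) (int p)" if "k \<in> {1..p - 1}" for k
  proof -
    have "\<not> p dvd k" using that assms(2) by (auto dest: dvd_imp_le)
    then have "coprime p k" using assms(1) by (rule prime_imp_coprime[rotated])
    then show ?thesis by (simp add: coprime_commute)
  qed
  have pow: "(\<chi> [^]\<^bsub>dirichlet_characters p\<^esub> j) a = \<chi> a ^ j" if "j > 0" for a and j :: nat
    using dirichlet_characters_pow[OF \<chi> that] .

  \<comment> \<open>A primitive root turns questions about values of \<chi> into questions about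
    exponents, since \<chi> is determined by \<open>\<chi> g\<close>.\<close>
  obtain g where g: "residue_primroot p g"
    using prime_primitive_root_exists[OF prime_gt_1_nat] assms(1) by blast
  have gen: "bij_betw (\<lambda>i. g ^ i mod p) {..<p - 1} {1..p - 1}"
  proof -
    have "totatives p = {1..p - 1}"
    proof (intro equalityI subsetI)
      fix k assume "k \<in> totatives p"
      then show "k \<in> {1..p - 1}"
        using totatives_less[of k p] assms(2) by (simp add: in_totatives_iff)
    next
      fix k assume "k \<in> {1..p - 1}"
      then show "k \<in> totatives p"
        using unit[of k] by (auto simp: in_totatives_iff)
    qed
    then show ?thesis
      using residue_primroot_is_generator[OF _ g] assms(1,2) by (simp add: totient_prime)
  qed
  have gen_ex: "\<exists>i. k = g ^ i mod p" if "k \<in> {1..p - 1}" for k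
    using that unfolding bij_betw_imp_surj_on[OF gen, symmetric] by blast
  have \<chi>_gen: "\<chi> (int (g ^ i mod p)) = \<chi> (int g) ^ i" for i
  proof -
    have "\<chi> (int (g ^ i mod p)) = \<chi> (int g ^ i)"
      by (rule cong) (simp add: zmod_int)
    then show ?thesis by (simp add: dirichlet_character_power[OF \<chi>])
  qed
  have \<chi>q: "\<chi> (int k) ^ q = 1" if "k \<in> {1..p - 1}" for k
  proof -
    have "\<chi> [^]\<^bsub>dirichlet_characters p\<^esub> q = principal_character p"
      using D.pow_ord_eq_1[OF assms(7)] assms(8) by (simp add: dirichlet_characters_def)
    then show ?thesis
      using pow[OF assms(5), of "int k"] unit[OF that] by (simp add: principal_character_def)
  qed
  \<comment> \<open>The order of \<chi> passes to its value at the generator: if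
    \<open>\<chi> g ^ i = 1\<close>, then \<open>\<chi> ^ i\<close> is 1 at every power of
    \<open>g\<close>, hence principal, so the order \<open>q\<close> divides
    \<open>i\<close>.\<close>
  have root: "\<chi> (int g) ^ i = 1 \<longleftrightarrow> q dvd i" for i
  proof
    assume i: "\<chi> (int g) ^ i = 1"
    show "q dvd i"
    \<comment> \<open>The exponent 0 is set apart because a pointwise 0th power is 1 also at
      non-units, where the principal character is 0.\<close>
    proof (cases "i = 0")
      case False
      have "\<chi> a ^ i = principal_character p a" for a
      proof (cases "coprime a (int p)")
        case True
        \<comment> \<open>The representative of \<open>a\<close> in \<open>{1..p - 1}\<close>;
          coprimality rules out the residue 0.\<close>
        define k where "k = nat (a mod int p)"
        have k: "int k = a mod int p" using assms(2) by (simp add: k_def)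
        have "\<not> int p dvd a"
          using True coprime_common_divisor[of a "int p" "int p"] assms(2) by auto
        then have "k \<noteq> 0" using k by (auto simp: dvd_eq_mod_eq_0)
        moreover have "int k < int p" unfolding k using assms(2) by simp
        ultimately have "k \<in> {1..p - 1}" by auto
        then obtain m where m: "k = g ^ m mod p" using gen_ex by blast
        have "\<chi> a = \<chi> (int k)" by (rule cong) (simp add: k)
        also have "\<dots> = \<chi> (int g) ^ m" unfolding m by (rule \<chi>_gen)
        finally have "\<chi> a ^ i = (\<chi> (int g) ^ i) ^ m"
          by (simp add: mult.commute flip: power_mult)
        then show ?thesis using i True by (simp add: principal_character_def)
      next
        case False
        then show ?thesis using \<chi> \<open>i \<noteq> 0\<close>
          by (simp add: principal_character_def dirichlet_character_def)
      qed
      then have "\<chi> [^]\<^bsub>dirichlet_characters p\<^esub> i = \<one>\<^bsub>dirichlet_characters p\<^esub>"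
        using pow False by (simp add: fun_eq_iff dirichlet_characters_def)
      then show ?thesis
        using D.pow_eq_id[OF assms(7)] assms(8) by simp
    qed simp
  next
    assume "q dvd i"
    \<comment> \<open>The bound \<open>p \<ge> 3\<close> puts the exponent 1 in range, so that
      \<open>\<chi>q\<close> applies to the residue of \<open>g\<close> itself.\<close>
    have "1 \<in> {..<p - 1}" using assms(2) by simp
    then have "\<chi> (int (g ^ 1 mod p)) ^ q = 1" by (intro \<chi>q bij_betwE[OF gen, rule_format])
    then have "\<chi> (int g) ^ q = 1" unfolding \<chi>_gen by simp
    then show "\<chi> (int g) ^ i = 1" using \<open>q dvd i\<close> by (auto simp: power_mult)
  qed

  define H where "H = {k \<in> {1..p - 1}. \<chi> (int k) = 1}"
  define S where "S = \<Sum>H"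
  \<comment> \<open>By \<open>root\<close>, the kernel \<open>H\<close> corresponds to the multiples
    of \<open>q\<close> below \<open>p - 1 = l * q\<close>, of which there are
    \<open>l\<close>.\<close>
  have "bij_betw (\<lambda>i. g ^ i mod p) {i \<in> {..<p - 1}. q dvd i} H"
    unfolding bij_betw_def
  proof
    show "inj_on (\<lambda>i. g ^ i mod p) {i \<in> {..<p - 1}. q dvd i}"
      using bij_betw_imp_inj_on[OF gen] by (rule inj_on_subset) blast
    show "(\<lambda>i. g ^ i mod p) ` {i \<in> {..<p - 1}. q dvd i} = H"
      unfolding H_def bij_betw_imp_surj_on[OF gen, symmetric]
      by (auto simp del: of_nat_mod simp: \<chi>_gen root)
  qed
  then have "card H = card {i \<in> {..<p - 1}. q dvd i}"
    by (simp add: bij_betw_same_card)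
  also have "{i \<in> {..<p - 1}. q dvd i} = (*) q ` {..<l}"
    unfolding lq using assms(5) by (auto simp: mult.commute[of q] elim!: dvdE)
  also have "card \<dots> = l"
    using assms(5) by (simp add: card_image inj_on_def)
  finally have card_H: "card H = l" .

  have neg: "\<chi> (-1) = -1"
  proof -
    have "\<chi> ((-1) ^ 2) = \<chi> (-1) ^ 2" by (rule dirichlet_character_power[OF \<chi>])
    then have sq: "\<chi> (-1) = 1 \<or> \<chi> (-1) = -1"
      by (simp add: dirichlet_character_one[OF \<chi>] power2_eq_1_iff)
    \<comment> \<open>Otherwise \<open>-1\<close> is a power \<open>g ^ m\<close> with
      \<open>q\<close> dividing \<open>m\<close>. Its \<open>l\<close>-th power is then a power of
      \<open>g ^ (p - 1)\<close>, hence 1 modulo \<open>p\<close>; but it is also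
      \<open>(-1) ^ l = -1\<close>, which forces \<open>p\<close> to divide 2.\<close>
    have "\<chi> (-1) \<noteq> 1"
    proof
      assume 1: "\<chi> (-1) = 1"
      have "p - 1 \<in> {1..p - 1}" using assms(2) by simp
      then obtain m where m: "p - 1 = g ^ m mod p" using gen_ex by blast
      have c: "[int g ^ m = -1] (mod int p)"
      proof -
        have "[int g ^ m = int (g ^ m mod p)] (mod int p)" by (simp add: zmod_int cong_def)
        also have "int (g ^ m mod p) = int p - 1" using assms(2) by (simp flip: m)
        also have "[int p - 1 = -1] (mod int p)" by (simp add: cong_iff_dvd_diff)
        finally show ?thesis .
      qed
      have "\<chi> (int g) ^ m = 1"
        using cong[OF c] 1 by (simp add: dirichlet_character_power[OF \<chi>])
      then obtain n where n: "m = q * n" using root by auto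
      have "[g ^ (p - 1) = 1] (mod p)"
        using g assms(1) by (metis residue_primroot_def coprime_commute euler_theorem totient_prime)
      then have "[(g ^ (p - 1)) ^ n = 1 ^ n] (mod p)" by (rule cong_pow)
      moreover have "(g ^ (p - 1)) ^ n = (g ^ m) ^ l"
        unfolding lq n by (simp add: mult_ac flip: power_mult)
      ultimately have "[int ((g ^ m) ^ l) = int 1] (mod int p)"
        by (simp only: cong_int_iff power_one)
      then have "[(int g ^ m) ^ l = 1] (mod int p)" by simp
      moreover have "[(int g ^ m) ^ l = (-1) ^ l] (mod int p)" using c by (rule cong_pow)
      ultimately have "[1 = - 1] (mod int p)"
        using \<open>odd l\<close> by (metis cong_sym cong_trans power_minus_odd power_one)
      then have "int p dvd 2" by (simp add: cong_iff_dvd_diff)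
      then show False using assms(2) zdvd_imp_le by fastforce
    qed
    with sq show ?thesis by blast
  qed
  have \<chi>_reflect: "\<chi> (int p - a) = - \<chi> a" for a
  proof -
    have "\<chi> (int p - a) = \<chi> (-1 * a)"
      by (rule cong) (simp add: cong_iff_dvd_diff)
    also have "\<dots> = \<chi> (-1) * \<chi> a"
      using \<chi> unfolding dirichlet_character_def by blast
    finally show ?thesis by (simp add: neg)
  qed
  have sum_neg: "(\<Sum>k | k \<in> {1..p - 1} \<and> \<chi> (int k) = -1. of_nat k) =
      (\<Sum>k\<in>H. of_nat (p - k) :: complex)"
    by (rule sum.reindex_bij_witness[of _ "\<lambda>k. p - k" "\<lambda>k. p - k"])
       (auto simp: H_def of_nat_diff \<chi>_reflect)

  have "E = 2 / of_nat q * (\<Sum>j | j \<in> {1..q - 1} \<and> odd j.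
      1 / of_nat p * (\<Sum>k = 1..p - 1. of_nat k * \<chi> (int k) ^ j))"
    unfolding assms(9) generalized_bernoulli_def
    by (intro arg_cong2[of _ _ _ _ "(*)"] sum.cong refl) (auto simp: pow)
  \<comment> \<open>Exchanging the sums isolates, for each \<open>k\<close>, the sum of the odd
    powers of the \<open>q\<close>-th root of unity \<open>\<chi> k\<close>.\<close>
  also have "\<dots> = 2 / of_nat q * (1 / of_nat p) *
      (\<Sum>k = 1..p - 1. of_nat k * (\<Sum>j | j \<in> {1..q - 1} \<and> odd j. \<chi> (int k) ^ j))"
    unfolding sum_distrib_left by (subst sum.swap) (simp add: mult_ac)
  also have "(\<Sum>k = 1..p - 1. of_nat k * (\<Sum>j | j \<in> {1..q - 1} \<and> odd j. \<chi> (int k) ^ j)) =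
      (\<Sum>k = 1..p - 1. of_nat k * (of_nat q / 2 *
        (if \<chi> (int k) = 1 then 1 else if \<chi> (int k) = -1 then -1 else 0)))"
    by (intro sum.cong arg_cong2[of _ _ _ _ "(*)"] sum_odd_powers_root_of_unity \<chi>q \<open>even q\<close>) auto
  also have "\<dots> = of_nat q / 2 * (\<Sum>k = 1..p - 1.
      (if \<chi> (int k) = 1 then of_nat k else 0) - (if \<chi> (int k) = -1 then of_nat k else 0))"
    unfolding sum_distrib_left by (intro sum.cong) auto
  also have "(\<Sum>k = 1..p - 1.
      (if \<chi> (int k) = 1 then of_nat k else 0) - (if \<chi> (int k) = -1 then of_nat k else 0)) =
      (\<Sum>k\<in>H. of_nat k) - (\<Sum>k\<in>H. of_nat (p - k) :: complex)"
    unfolding sum_neg[symmetric]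
    unfolding H_def by (simp only: sum_subtractf sum.inter_filter finite_atLeastAtMost)
  \<comment> \<open>The truncated subtraction is exact since \<open>k < p\<close> on
    \<open>H\<close>; the difference of the two sums becomes
    \<open>2 * S - p * card H\<close>.\<close>
  also have "(\<Sum>k\<in>H. of_nat (p - k) :: complex) = (\<Sum>k\<in>H. of_nat p - of_nat k)"
    by (intro sum.cong) (auto simp: H_def of_nat_diff)
  also have "(\<Sum>k\<in>H. of_nat k) - \<dots> = (of_int (2 * int S - int p * int l) :: complex)"
    by (simp add: sum_subtractf S_def card_H)
  finally have E: "E = 2 / of_nat q * (1 / of_nat p) *
      (of_nat q / 2 * of_int (2 * int S - int p * int l))" .
  \<comment> \<open>For \<open>d = 0\<close> both sides are 0 by the convention for
    division.\<close>
  have cancel: "2 / c * (1 / d) * (c / 2 * x) = x / d" if "c \<noteq> 0" for c d x :: complex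
    using that by (simp add: divide_simps)
  have "E = of_int (2 * int S - int p * int l) / of_nat p"
    unfolding E by (rule cancel) (use assms(5) in simp)
  \<comment> \<open>Parity alone excludes 0, so the value of \<open>S\<close> never has to be
    computed.\<close>
  moreover have "odd (2 * int S - int p * int l)"
    using \<open>odd p\<close> \<open>odd l\<close> by simp
  then have "2 * int S - int p * int l \<noteq> 0" by presburger
  then have "(of_int (2 * int S - int p * int l) :: complex) \<noteq> 0"
    by (simp only: of_int_eq_0_iff not_False_eq_True)
  ultimately show ?thesis using assms(2) by simp
qed

end
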